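(* Let $w_0:[0,\infty)\to[0,\infty)$ be a decreasing integrable function with $\int_0^\infty w_0(x)\,dx=1$, which is initial data for the LSW system and satisfies $L(0)=1$. Let $\beta_0(\cdot)$ be the beta function of $w_0$ and suppose $\sup\beta_0(\cdot)\le\beta_\infty<\infty$. Let $w(x,t)$, $x\ge0$, $t>0$, be the solution of the LSW system with initial data $w_0$. Then there is a constant $C=C(\beta_\infty)$, depending only on $\beta_\infty$, such that $$\Lambda(T)\le CT,\qquad \frac{1}{E(T)^3}\le CT,\qquad T>1 .$$
   Context: Beta function. For a nonnegative decreasing integrable function $w$ on $[0,\infty)$ (not identically zero) let $X$ be the positive random variable with $P(X>x)=w(x)/w(0)$, let $\|X\|_\infty\in(0,\infty]$ be its essential supremum, and let $h(x)=\int_x^\infty w(x')\,dx'$. Assuming $h$ is $C^2$ on $[0,\|X\|_\infty)$, the beta function of $w$ (or of $X$) is $\beta(x)=h''(x)h(x)/h'(x)^2$, $0\le x<\|X\|_\infty$. Beta functions are assumed to exist in this sense whenever mentioned. LSW system. It consists of $$\frac{\partial w(x,t)}{\partial t}=\left[1-\left\{\frac{x}{L(t)}\right\}^{1/3}\right]\frac{\partial w}{\partial x}(x,t),\quad x>0,\ t>0,\qquad \int_0^\infty w(x,t)\,dx=1,$$ with $w(x,0)=w_0(x)$; the function $L(t)>0$ is determined by the integral constraint and is given by $L(t)^{1/3}=\frac13\int_0^\infty x^{-2/3}w(x,t)\,dx\,/\,w(0,t)$ (also at $t=0$ with $w(\cdot,0)=w_0$). Solutions are understood via characteristics: $L$ is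 continuous and positive and $w(x,t)=w_0(F(x,t))$, where $F(x,t)=x(0)$ and $x(s)$, $0\le s\le t$, solves $dx/ds=-[1-\{x/L(s)\}^{1/3}]$, $x(t)=x$. Put $c(\cdot,t)=-\partial w(\cdot,t)/\partial x$ (as a measure, if necessary). The mean cluster volume is $\Lambda(t)=\int_0^\infty x\,c(x,t)\,dx\big/\int_0^\infty c(x,t)\,dx=1/w(0,t)$, and the energy is $E(t)=\int_0^\infty x^{2/3}c(x,t)\,dx=\frac23\int_0^\infty x^{-1/3}w(x,t)\,dx$. *)

theory Defs
  imports "HOL-Probability.Probability" "HOL-Probability.Essential_Supremum"
begin

(* mu is the law of the positive random variable X with P(X > x) = w x / w 0.
   Functions on [0, oo) are represented by functions on the reals whose values at
   negative arguments are never used. *)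
definition tail_law :: "(real \<Rightarrow> real) \<Rightarrow> real measure \<Rightarrow> bool" where
  "tail_law w \<mu> \<longleftrightarrow> prob_space \<mu> \<and> sets \<mu> = sets borel \<and>
     (\<forall>x\<ge>0. measure \<mu> {x<..} = w x / w 0)"

(* The interval [0, ||X||_oo), where the essential supremum may be infinite. *)
definition beta_dom :: "real measure \<Rightarrow> real set" where
  "beta_dom \<mu> = {x. 0 \<le> x \<and> ereal x < esssup \<mu> ereal}"

definition tail_integral :: "(real \<Rightarrow> real) \<Rightarrow> real \<Rightarrow> real" where
  "tail_integral w x = (LBINT x':{x..}. w x')"

(* Derivative relative to I; on [0, b) it is the one-sided derivative at 0. *)
definition deriv_on :: "real set \<Rightarrow> (real \<Rightarrow> real) \<Rightarrow> real \<Rightarrow> real" where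
  "deriv_on I f x = vector_derivative f (at x within I)"

definition C2_on :: "real set \<Rightarrow> (real \<Rightarrow> real) \<Rightarrow> bool" where
  "C2_on I f \<longleftrightarrow> f differentiable_on I \<and> deriv_on I f differentiable_on I \<and>
     continuous_on I (deriv_on I (deriv_on I f))"

definition beta_exists :: "(real \<Rightarrow> real) \<Rightarrow> real measure \<Rightarrow> bool" where
  "beta_exists w \<mu> \<longleftrightarrow> tail_law w \<mu> \<and> C2_on (beta_dom \<mu>) (tail_integral w)"

definition beta_fun :: "(real \<Rightarrow> real) \<Rightarrow> real measure \<Rightarrow> real \<Rightarrow> real" where
  "beta_fun w \<mu> x =
     (let I = beta_dom \<mu>; h = tail_integral w
      in deriv_on I (deriv_on I h) x * h x / (deriv_on I h x)\<^sup>2)"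

(* y is the characteristic through x at time t, followed back to time 0. *)
definition lsw_characteristic ::
  "(real \<Rightarrow> real) \<Rightarrow> real \<Rightarrow> real \<Rightarrow> (real \<Rightarrow> real) \<Rightarrow> bool" where
  "lsw_characteristic L x t y \<longleftrightarrow> y t = x \<and>
     (\<forall>s\<in>{0..t}. 0 \<le> y s \<and>
        (y has_real_derivative - (1 - root 3 (y s / L s))) (at s within {0..t}))"

(* The value y 0 below is F(x,t). The right-hand side of the characteristic equation is
   increasing in the space variable, so the backward problem has exactly one solution and
   the existential quantifier over y determines w x t. *)
definition lsw_solution ::
  "(real \<Rightarrow> real) \<Rightarrow> (real \<Rightarrow> real) \<Rightarrow> (real \<Rightarrow> real \<Rightarrow> real) \<Rightarrow> bool" where
  "lsw_solution w0 L w \<longleftrightarrow>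
     continuous_on {0..} L \<and> (\<forall>t\<ge>0. 0 < L t) \<and>
     (\<forall>t\<ge>0. \<forall>x\<ge>0. \<exists>y. lsw_characteristic L x t y \<and> w x t = w0 (y 0)) \<and>
     (\<forall>t\<ge>0. set_integrable lborel {0..} (\<lambda>x. w x t) \<and> (LBINT x:{0..}. w x t) = 1) \<and>
     (\<forall>t\<ge>0. root 3 (L t) = (1/3) * (LBINT x:{0..}. x powr (-2/3) * w x t) / w 0 t)"

(* The Lebesgue-Stieltjes measure c(.,t) = - dw(.,t)/dx; truncating the argument at 0
   leaves no mass on (-oo, 0]. *)
definition cluster_measure :: "(real \<Rightarrow> real \<Rightarrow> real) \<Rightarrow> real \<Rightarrow> real measure" where
  "cluster_measure w t = interval_measure (\<lambda>x. - w (max 0 x) t)"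

definition mean_volume :: "(real \<Rightarrow> real \<Rightarrow> real) \<Rightarrow> real \<Rightarrow> real" where
  "mean_volume w t =
     (LINT x:{0..}|cluster_measure w t. x) / (LINT x:{0..}|cluster_measure w t. 1)"

definition energy :: "(real \<Rightarrow> real \<Rightarrow> real) \<Rightarrow> real \<Rightarrow> real" where
  "energy w t = (LINT x:{0..}|cluster_measure w t. x powr (2/3))"

end

theory Submission
  imports Defs
begin

text \<open>
  Write \<open>h\<close> for the tail integral of the initial datum \<open>w\<^sub>0\<close> and \<open>B\<close> for a positive upper bound
  of its beta function, and let \<open>F(x,t)\<close> be the foot of the characteristic through \<open>(x,t)\<close>.
  On the support of \<open>w\<^sub>0\<close> the beta function is \<open>h (1/w\<^sub>0)'\<close>, so the bound by \<open>B\<close> says that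
  \<open>1/w\<^sub>0\<close> has slope at most \<open>B/h\<close>; integrated over an interval this is
  \<open>inverse_profile_increment\<close>.

  The cube root is concave, hence the foot map \<open>F(\<cdot>,t)\<close> is convex (\<open>characteristic_convex\<close>), and it is
  increasing and nonexpansive. Convexity makes the bound on the beta function survive the
  evolution: beyond \<open>x\<close> the map \<open>F(\<cdot>,t)\<close> is at least as steep as its chord over \<open>[0,x]\<close>, and a change
  of variables gives, with \<open>h\<^sub>t\<close> the tail integral of \<open>w(\<cdot>,t)\<close>,
  \<open>1/w(x,t) - 1/w(0,t) \<le> B x / h\<^sub>t(x)\<close> (\<open>reparametrised_inverse_increment\<close>, \<open>inverse_increment\<close>).
  The argument uses chords of \<open>F\<close> only, so differentiability of the flow is never needed. Three
  consequences of this inequality give the theorem.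

  Growth of the mean volume \<open>\<Lambda>(t) = 1/w(0,t)\<close>: the characteristic that reaches \<open>0\<close> at time \<open>t + d\<close> is
  at some \<open>x \<le> d\<close> at time \<open>t\<close>, so \<open>\<Lambda>(t+d) - \<Lambda>(t) = 1/w(x,t) - 1/w(0,t) \<le> 2 B d\<close> for small \<open>d\<close>, and
  summing over a fine subdivision yields \<open>\<Lambda>(T) \<le> \<Lambda>(0) + 2 B T\<close> (\<open>volume_growth\<close>).

  No escape of mass: as long as \<open>h\<^sub>t > 1/2\<close>, the inequality reads \<open>w(x,t) \<ge> 1/(\<Lambda> + 2 B x)\<close>. The
  integral of the right-hand side diverges logarithmically, so half of the mass lies below \<open>k \<Lambda>(t)\<close>
  with \<open>k = exp B / (2 B)\<close> (\<open>tail_integral_le_half\<close>).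

  Comparison of moments: with half of the mass below \<open>k \<Lambda>\<close>, the moments of order \<open>1/3\<close> and \<open>2/3\<close>
  are bounded below by the corresponding powers of \<open>\<Lambda>\<close>. At time \<open>0\<close> the condition \<open>L(0) = 1\<close> thus
  bounds \<open>\<Lambda>(0)\<close> (\<open>initial_volume_bound\<close>), and at time \<open>T\<close> the energy satisfies
  \<open>1/E(T)\<^sup>3 \<le> 8 k \<Lambda>(T)\<close> (\<open>inverse_cubed_energy_bound\<close>).
\<close>

section \<open>Characteristics\<close>

text \<open>A comparison principle backwards in time: a function that cannot decrease while it is positive,
  and that is not positive at the end, was not positive at the beginning.\<close>
lemma barrier_at_left_end:
  fixes u u' :: "real \<Rightarrow> real"
  assumes ab: "a \<le> b"
    and der: "\<And>s. s \<in> {a..b} \<Longrightarrow> (u has_real_derivative u' s) (at s within {a..b})"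
    and pos: "\<And>s. s \<in> {a..b} \<Longrightarrow> 0 < u s \<Longrightarrow> 0 \<le> u' s"
    and final: "u b \<le> 0"
  shows "u a \<le> 0"
proof (rule ccontr)
  assume ua: "\<not> u a \<le> 0"
  have cont: "continuous_on {a..b} u"
    using der by (meson DERIV_continuous_on)
  have "closed ({a..b} \<inter> u -` {..0})"
    by (rule continuous_closed_preimage[OF cont]) auto
  then have "compact ({a..b} \<inter> ({a..b} \<inter> u -` {..0}))"
    by (intro compact_Int_closed) auto
  then have comp: "compact {s\<in>{a..b}. u s \<le> 0}"
    by (rule back_subst[of compact]) auto
  have "b \<in> {s\<in>{a..b}. u s \<le> 0}"
    using ab final by auto
  with compact_attains_inf[OF comp] obtain s0
    where s0: "s0 \<in> {a..b}" "u s0 \<le> 0" and least: "\<And>s. s \<in> {a..b} \<Longrightarrow> u s \<le> 0 \<Longrightarrow> s0 \<le> s"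
    by blast
  \<comment> \<open>\<open>s0\<close> is the first time at which \<open>u\<close> is not positive, so \<open>u\<close> cannot decrease on \<open>[a, s0)\<close>.\<close>
  have "a < s0"
    using s0 ua by (cases "s0 = a") auto
  have "\<exists>s\<in>{a<..<s0}. u s0 - u a = (\<lambda>h. u' s * h) (s0 - a)"
  proof (rule mvt_simple[OF \<open>a < s0\<close>])
    fix s assume "a \<le> s" "s \<le> s0"
    then have "(u has_real_derivative u' s) (at s within {a..s0})"
      using s0 by (intro has_field_derivative_subset[OF der]) auto
    then show "(u has_derivative (\<lambda>h. u' s * h)) (at s within {a..s0})"
      by (simp add: has_field_derivative_def)
  qed
  then obtain s where s: "a < s" "s < s0" "u s0 - u a = u' s * (s0 - a)"
    by auto
  have "0 < u s"
    using s s0 least[of s] by force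
  then have "0 \<le> u' s"
    using s s0 by (intro pos) auto
  then have "u a \<le> u s0"
    using s \<open>a < s0\<close> by (smt (verit) mult_nonneg_nonneg)
  with s0 ua show False by simp
qed

lemma root_3_concave:
  fixes a b p q :: real
  assumes "0 \<le> a" "0 \<le> b" "0 \<le> p" "0 \<le> q" "p + q = 1"
  shows "p * root 3 a + q * root 3 b \<le> root 3 (p * a + q * b)"
proof -
  have "convex_on {0::real..} (\<lambda>x. x ^ 3)"
    by (rule convex_power_odd) simp
  then have "(p * root 3 a + q * root 3 b) ^ 3 \<le> p * root 3 a ^ 3 + q * root 3 b ^ 3"
    using assms unfolding convex_on_def by (metis atLeast_iff real_root_ge_zero real_scaleR_def)
  also have "\<dots> = p * a + q * b"
    using assms by simp
  finally have "root 3 ((p * root 3 a + q * root 3 b) ^ 3) \<le> root 3 (p * a + q * b)"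
    by simp
  then show ?thesis
    using assms by (simp add: real_root_power_cancel)
qed

lemma characteristic_end: "lsw_characteristic L x t y \<Longrightarrow> y t = x"
  by (simp add: lsw_characteristic_def)

lemma characteristic_nonneg: "lsw_characteristic L x t y \<Longrightarrow> 0 \<le> s \<Longrightarrow> s \<le> t \<Longrightarrow> 0 \<le> y s"
  by (simp add: lsw_characteristic_def)

lemma characteristic_deriv:
  "lsw_characteristic L x t y \<Longrightarrow> s \<in> {0..t} \<Longrightarrow>
     (y has_real_derivative - (1 - root 3 (y s / L s))) (at s within {0..t})"
  by (simp add: lsw_characteristic_def)

lemma characteristic_restrict:
  assumes "lsw_characteristic L x t y" "0 \<le> s" "s \<le> t"
  shows "lsw_characteristic L (y s) s y"
  unfolding lsw_characteristic_def
proof (intro conjI ballI)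
  fix r assume r: "r \<in> {0..s}"
  show "0 \<le> y r"
    using assms r by (auto intro: characteristic_nonneg)
  show "(y has_real_derivative - (1 - root 3 (y r / L r))) (at r within {0..s})"
    using assms r by (intro has_field_derivative_subset[OF characteristic_deriv[OF assms(1)]]) auto
qed simp

text \<open>Taking equal end points, this also gives uniqueness of the foot of a characteristic.\<close>
lemma characteristic_mono:
  assumes L: "\<And>s. 0 \<le> s \<Longrightarrow> 0 < L s" and t: "0 \<le> t"
    and y1: "lsw_characteristic L x1 t y1" and y2: "lsw_characteristic L x2 t y2" and "x1 \<le> x2"
  shows "y1 0 \<le> y2 0"
proof -
  have "y1 0 - y2 0 \<le> 0"
  proof (rule barrier_at_left_end[OF t,
        where u = "\<lambda>s. y1 s - y2 s" and u' = "\<lambda>s. root 3 (y1 s / L s) - root 3 (y2 s / L s)"])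
    fix s assume s: "s \<in> {0..t}"
    show "((\<lambda>s. y1 s - y2 s) has_real_derivative root 3 (y1 s / L s) - root 3 (y2 s / L s))
            (at s within {0..t})"
      using DERIV_diff[OF characteristic_deriv[OF y1 s] characteristic_deriv[OF y2 s]] by simp
    assume "0 < y1 s - y2 s"
    then show "0 \<le> root 3 (y1 s / L s) - root 3 (y2 s / L s)"
      using L[of s] s by (simp add: divide_right_mono)
  next
    show "y1 t - y2 t \<le> 0"
      using characteristic_end[OF y1] characteristic_end[OF y2] \<open>x1 \<le> x2\<close> by simp
  qed
  then show ?thesis by simp
qed

lemma characteristic_nonexpansive:
  assumes L: "\<And>s. 0 \<le> s \<Longrightarrow> 0 < L s" and t: "0 \<le> t"
    and y1: "lsw_characteristic L x1 t y1" and y2: "lsw_characteristic L x2 t y2" and "x1 \<le> x2"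
  shows "y2 0 - y1 0 \<le> x2 - x1"
proof -
  have "y2 0 - y1 0 - (x2 - x1) \<le> 0"
  proof (rule barrier_at_left_end[OF t,
        where u = "\<lambda>s. y2 s - y1 s - (x2 - x1)"
          and u' = "\<lambda>s. root 3 (y2 s / L s) - root 3 (y1 s / L s)"])
    fix s assume s: "s \<in> {0..t}"
    show "((\<lambda>s. y2 s - y1 s - (x2 - x1)) has_real_derivative
             root 3 (y2 s / L s) - root 3 (y1 s / L s)) (at s within {0..t})"
      using DERIV_diff[OF DERIV_diff[OF characteristic_deriv[OF y2 s] characteristic_deriv[OF y1 s]]
          DERIV_const[of "x2 - x1"]] by simp
    assume "0 < y2 s - y1 s - (x2 - x1)"
    then show "0 \<le> root 3 (y2 s / L s) - root 3 (y1 s / L s)"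
      using L[of s] s \<open>x1 \<le> x2\<close> by (simp add: divide_right_mono)
  next
    show "y2 t - y1 t - (x2 - x1) \<le> 0"
      using characteristic_end[OF y1] characteristic_end[OF y2] by simp
  qed
  then show ?thesis by simp
qed

text \<open>The foot of a characteristic is a convex function of its end point. The difference between a
  characteristic and a convex combination of two others meets the hypotheses of the comparison
  principle because the cube root is concave and increasing.\<close>
lemma characteristic_convex:
  assumes L: "\<And>s. 0 \<le> s \<Longrightarrow> 0 < L s" and t: "0 \<le> t"
    and y1: "lsw_characteristic L x1 t y1" and y2: "lsw_characteristic L x2 t y2"
    and y: "lsw_characteristic L (p * x1 + q * x2) t y"
    and pq: "0 \<le> p" "0 \<le> q" "p + q = 1"
  shows "y 0 \<le> p * y1 0 + q * y2 0"
proof -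
  define r where "r f s = root 3 (f s / L s)" for f :: "real \<Rightarrow> real" and s
  have "y 0 - (p * y1 0 + q * y2 0) \<le> 0"
  proof (rule barrier_at_left_end[OF t, where u = "\<lambda>s. y s - (p * y1 s + q * y2 s)"
          and u' = "\<lambda>s. r y s - (p * r y1 s + q * r y2 s)"])
    fix s assume s: "s \<in> {0..t}"
    have "((\<lambda>s. y s - (p * y1 s + q * y2 s)) has_real_derivative
             - (1 - r y s) - (p * (- (1 - r y1 s)) + q * (- (1 - r y2 s)))) (at s within {0..t})"
      unfolding r_def
      by (intro DERIV_diff DERIV_add DERIV_cmult characteristic_deriv[OF y s]
            characteristic_deriv[OF y1 s] characteristic_deriv[OF y2 s])
    moreover have "- (1 - r y s) - (p * (- (1 - r y1 s)) + q * (- (1 - r y2 s)))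
        = r y s - (p * r y1 s + q * r y2 s)"
      using pq(3) by algebra
    ultimately show "((\<lambda>s. y s - (p * y1 s + q * y2 s)) has_real_derivative
             r y s - (p * r y1 s + q * r y2 s)) (at s within {0..t})"
      by (simp only:)
    assume pos: "0 < y s - (p * y1 s + q * y2 s)"
    have Ls: "0 < L s" and nn: "0 \<le> y1 s" "0 \<le> y2 s"
      using s L characteristic_nonneg[OF y1] characteristic_nonneg[OF y2] by auto
    have "p * r y1 s + q * r y2 s \<le> root 3 (p * (y1 s / L s) + q * (y2 s / L s))"
      unfolding r_def using Ls nn pq by (intro root_3_concave) auto
    also have "p * (y1 s / L s) + q * (y2 s / L s) = (p * y1 s + q * y2 s) / L s"
      by (simp add: add_divide_distrib)
    also have "root 3 \<dots> \<le> r y s"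
      unfolding r_def using pos Ls by (simp add: divide_right_mono)
    finally show "0 \<le> r y s - (p * r y1 s + q * r y2 s)" by simp
  next
    show "y t - (p * y1 t + q * y2 t) \<le> 0"
      using characteristic_end[OF y] characteristic_end[OF y1] characteristic_end[OF y2] by simp
  qed
  then show ?thesis by simp
qed

lemma characteristic_speed:
  assumes L: "\<And>s. 0 \<le> s \<Longrightarrow> 0 < L s" and y: "lsw_characteristic L x t y" and s: "0 \<le> s" "s \<le> t"
  shows "y s \<le> x + (t - s)"
proof -
  have "y s - (x + (t - s)) \<le> 0"
  proof (rule barrier_at_left_end[OF s(2),
        where u = "\<lambda>r. y r - (x + (t - r))" and u' = "\<lambda>r. root 3 (y r / L r)"])
    fix r assume r: "r \<in> {s..t}"
    have "(y has_real_derivative - (1 - root 3 (y r / L r))) (at r within {s..t})"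
      using r s by (intro has_field_derivative_subset[OF characteristic_deriv[OF y]]) auto
    then show "((\<lambda>r. y r - (x + (t - r))) has_real_derivative root 3 (y r / L r))
            (at r within {s..t})"
      by (auto intro!: derivative_eq_intros)
    show "0 \<le> root 3 (y r / L r)"
      using characteristic_nonneg[OF y, of r] L[of r] r s by simp
  next
    show "y t - (x + (t - t)) \<le> 0"
      using characteristic_end[OF y] by simp
  qed
  then show ?thesis by simp
qed

section \<open>Decreasing profiles of unit mass\<close>

text \<open>The common properties of the initial datum and of the solution at each later time. Only values
  on the nonnegative half-line matter.\<close>
locale decreasing_profile =
  fixes f :: "real \<Rightarrow> real"
  assumes nonneg: "\<And>x. 0 \<le> x \<Longrightarrow> 0 \<le> f x"
    and decreasing: "\<And>x y. 0 \<le> x \<Longrightarrow> x \<le> y \<Longrightarrow> f y \<le> f x"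
    and integrable: "set_integrable lborel {0..} f"
    and mass: "(LBINT x:{0..}. f x) = 1"
begin

lemma integrable_subset: "A \<subseteq> {0..} \<Longrightarrow> A \<in> sets borel \<Longrightarrow> set_integrable lborel A f"
  by (rule set_integrable_subset[OF integrable]) auto

lemma tail_integral_0: "tail_integral f 0 = 1"
  by (simp add: tail_integral_def mass)

lemma tail_integral_split:
  assumes "0 \<le> a" "a \<le> b"
  shows "tail_integral f a = (LBINT x:{a..<b}. f x) + tail_integral f b"
proof -
  have "{a..} = {a..<b} \<union> {b..}" using assms by auto
  then show ?thesis
    unfolding tail_integral_def using assms
    by (simp only:, intro set_integral_Un integrable_subset) auto
qed

lemma set_integral_const_Ico:
  fixes c :: real assumes "a \<le> b" shows "(LBINT x:{a..<b}. c) = (b - a) * c"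
  using assms by (simp add: set_lebesgue_integral_def)

lemma integral_Ico_bounds:
  assumes "0 \<le> a" "a \<le> b"
  shows "(b - a) * f b \<le> (LBINT x:{a..<b}. f x)" "(LBINT x:{a..<b}. f x) \<le> (b - a) * f a"
proof -
  have c: "set_integrable lborel {a..<b} (\<lambda>x. c)" for c :: real
    unfolding set_integrable_def using assms by (intro integrable_scaleR_left integrable_real_indicator) auto
  have i: "set_integrable lborel {a..<b} f"
    using assms by (intro integrable_subset) auto
  show "(b - a) * f b \<le> (LBINT x:{a..<b}. f x)"
    using set_integral_mono[OF c i, of "f b"] assms decreasing
    by (auto simp: set_integral_const_Ico)
  show "(LBINT x:{a..<b}. f x) \<le> (b - a) * f a"
    using set_integral_mono[OF i c, of "f a"] assms decreasing
    by (auto simp: set_integral_const_Ico)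
qed

lemma tail_integral_nonneg: "0 \<le> x \<Longrightarrow> 0 \<le> tail_integral f x"
  unfolding tail_integral_def set_lebesgue_integral_def
  by (intro Bochner_Integration.integral_nonneg) (auto simp: indicator_def nonneg)

lemma tail_integral_decrement:
  assumes "0 \<le> a" "a \<le> b"
  shows "(b - a) * f b \<le> tail_integral f a - tail_integral f b"
    and "tail_integral f a - tail_integral f b \<le> (b - a) * f a"
  using tail_integral_split[OF assms] integral_Ico_bounds[OF assms] by auto

lemma tail_integral_decreasing:
  assumes "0 \<le> a" "a \<le> b" shows "tail_integral f b \<le> tail_integral f a"
  using tail_integral_decrement(1)[OF assms] nonneg[of b] assms by (smt (verit) mult_nonneg_nonneg)

lemma positive_at_0: "0 < f 0"
proof (rule ccontr)
  assume "\<not> 0 < f 0"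
  then have "f x = 0" if "0 \<le> x" for x
    using decreasing[of 0 x] nonneg[of x] that by auto
  then have "(LBINT x:{0..}. f x) = (LBINT x:{0..}. 0::real)"
    by (subst set_lebesgue_integral_cong[where g = "\<lambda>_. 0"]) auto
  with mass show False by (simp add: set_lebesgue_integral_def)
qed

lemma le_inverse: assumes "0 < x" shows "f x \<le> 1 / x"
proof -
  have "x * f x \<le> 1"
    using tail_integral_decrement(1)[of 0 x] tail_integral_nonneg[of x] tail_integral_0 assms by simp
  then show ?thesis using assms by (simp add: field_simps)
qed

lemma tendsto_0: "(f \<longlongrightarrow> 0) at_top"
proof (rule tendsto_sandwich)
  show "\<forall>\<^sub>F x in at_top. 0 \<le> f x"
    using eventually_ge_at_top[of 0] by eventually_elim (rule nonneg)
  show "\<forall>\<^sub>F x in at_top. f x \<le> 1 / x"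
    using eventually_gt_at_top[of 0] by eventually_elim (rule le_inverse)
  show "((\<lambda>x::real. 1 / x) \<longlongrightarrow> 0) at_top"
    by (rule tendsto_divide_0[OF tendsto_const]) (simp add: filterlim_at_top_imp_at_infinity filterlim_ident)
qed simp

end

section \<open>Profiles with a bounded beta function\<close>

lemma tail_law_right_continuous:
  assumes law: "tail_law w \<mu>" and w0: "w 0 \<noteq> 0" and x: "0 \<le> x"
  shows "(w \<longlongrightarrow> w x) (at_right x)"
proof -
  interpret real_distribution \<mu>
    using law by (intro real_distribution.intro) (auto simp: tail_law_def real_distribution_axioms_def)
  have tail: "w y = w 0 * (1 - cdf \<mu> y)" if "0 \<le> y" for y
  proof -
    have "{y<..} = space \<mu> - {..y}" by auto
    then have "measure \<mu> {y<..} = 1 - cdf \<mu> y"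
      using prob_compl[of "{..y}"] by (simp add: cdf_def)
    moreover have "measure \<mu> {y<..} = w y / w 0"
      using law that by (simp add: tail_law_def)
    ultimately show ?thesis using w0 by (simp add: field_simps)
  qed
  have "((\<lambda>y. w 0 * (1 - cdf \<mu> y)) \<longlongrightarrow> w 0 * (1 - cdf \<mu> x)) (at_right x)"
    using cdf_is_right_cont[of x] by (intro tendsto_intros) (simp add: continuous_within)
  moreover have "\<forall>\<^sub>F y in at_right x. w 0 * (1 - cdf \<mu> y) = w y"
    using eventually_at_right_less[of x] by eventually_elim (use x in \<open>simp add: tail[symmetric]\<close>)
  ultimately show ?thesis
    unfolding tail[OF x] by (rule Lim_transform_eventually)
qed

text \<open>The interval below the essential supremum of \<open>X\<close> is where the tail of the law is positive. This
  turns the domain of the beta function into the support of the profile.\<close>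
lemma beta_dom_eq_support:
  assumes law: "tail_law w \<mu>" and w0: "0 < w 0"
  shows "beta_dom \<mu> = {x. 0 \<le> x \<and> 0 < w x}"
proof -
  interpret real_distribution \<mu>
    using law by (intro real_distribution.intro) (auto simp: tail_law_def real_distribution_axioms_def)
  have meas: "measure \<mu> {x<..} = w x / w 0" if "0 \<le> x" for x
    using law that by (simp add: tail_law_def)
  have "ereal x < esssup \<mu> ereal \<longleftrightarrow> 0 < w x" if x: "0 \<le> x" for x
  proof
    assume "ereal x < esssup \<mu> ereal"
    then have "0 < emeasure \<mu> {x<..}"
      using esssup_pos_measure[of ereal \<mu> "ereal x"] by (simp add: greaterThan_def)
    then have "0 < measure \<mu> {x<..}"
      by (simp add: emeasure_eq_measure)
    then show "0 < w x"
      using meas[OF x] w0 by (simp add: zero_less_divide_iff)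
  next
    assume pos: "0 < w x"
    show "ereal x < esssup \<mu> ereal"
    proof (rule ccontr)
      assume "\<not> ereal x < esssup \<mu> ereal"
      then have le: "ereal y \<le> esssup \<mu> ereal \<Longrightarrow> \<not> x < y" for y
        by (metis ereal_less_eq(3) linorder_not_less order_trans)
      have "AE y in \<mu>. \<not> x < y"
        by (rule eventually_mono[OF esssup_AE[of ereal \<mu>] le])
      then have "measure \<mu> {x<..} = 0"
        by (intro prob_eq_0[THEN iffD2]) auto
      then show False using meas[OF x] pos w0 by simp
    qed
  qed
  then show ?thesis by (auto simp: beta_dom_def)
qed

text \<open>Beta functions are nonnegative, so requiring \<open>0 \<le> B\<close> loses nothing.\<close>
locale beta_bounded_profile = decreasing_profile w for w :: "real \<Rightarrow> real" +
  fixes \<mu> :: "real measure" and B :: real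
  assumes beta_exists: "beta_exists w \<mu>"
    and beta_le: "\<And>x. x \<in> beta_dom \<mu> \<Longrightarrow> beta_fun w \<mu> x \<le> B"
    and B_nonneg: "0 \<le> B"
begin

lemma tail_law: "tail_law w \<mu>" and C2: "C2_on (beta_dom \<mu>) (tail_integral w)"
  using beta_exists by (auto simp: beta_exists_def)

lemma dom_eq: "beta_dom \<mu> = {x. 0 \<le> x \<and> 0 < w x}"
  by (rule beta_dom_eq_support[OF tail_law positive_at_0])

lemma right_continuous: "0 \<le> x \<Longrightarrow> (w \<longlongrightarrow> w x) (at_right x)"
  using tail_law_right_continuous[OF tail_law] positive_at_0 by simp

lemma support_right_open:
  assumes "0 \<le> x" "0 < w x"
  obtains y where "x < y" "0 < w y"
proof -
  have "\<forall>\<^sub>F y in at_right x. 0 < w y \<and> x < y"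
    using order_tendstoD(1)[OF right_continuous[OF assms(1)] assms(2)] eventually_at_right_less[of x]
    by (rule eventually_conj)
  then show ?thesis
    using that eventually_happens'[OF trivial_limit_at_right_real] by blast
qed

lemma tail_integral_pos:
  assumes "0 \<le> x" "0 < w x" shows "0 < tail_integral w x"
proof -
  obtain y where y: "x < y" "0 < w y" using support_right_open assms by blast
  then have "0 < (y - x) * w y" by simp
  moreover have "(y - x) * w y \<le> tail_integral w x - tail_integral w y" "0 \<le> tail_integral w y"
    using tail_integral_decrement(1)[of x y] tail_integral_nonneg[of y] y assms by auto
  ultimately show ?thesis by linarith
qed

text \<open>Differentiability of the tail integral is part of the hypothesis, so its derivative may be computed
  from the right, where right continuity of the profile suffices.\<close>
lemma deriv_tail_integral:
  assumes x: "x \<in> beta_dom \<mu>"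
  shows "deriv_on (beta_dom \<mu>) (tail_integral w) x = - w x"
proof -
  let ?h = "tail_integral w"
  have x0: "0 \<le> x" "0 < w x" using x by (auto simp: dom_eq)
  obtain y where y: "x < y" "0 < w y" using support_right_open x0 by blast
  have sub: "{x..y} \<subseteq> beta_dom \<mu>"
    using x0 y decreasing by (auto simp: dom_eq intro: less_le_trans)
  have "?h differentiable (at x within beta_dom \<mu>)"
    using C2 x by (simp add: C2_on_def differentiable_on_def)
  then have "(?h has_vector_derivative deriv_on (beta_dom \<mu>) ?h x) (at x within beta_dom \<mu>)"
    unfolding deriv_on_def by (rule vector_derivative_works[THEN iffD1])
  then have "(?h has_real_derivative deriv_on (beta_dom \<mu>) ?h x) (at x within {x..y})"
    using has_vector_derivative_within_subset[OF _ sub]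
    by (simp add: has_real_derivative_iff_has_vector_derivative)
  then have lim: "((\<lambda>z. (?h z - ?h x) / (z - x)) \<longlongrightarrow> deriv_on (beta_dom \<mu>) ?h x) (at_right x)"
    using y by (simp add: has_field_derivative_iff at_within_Icc_at_right)
  have "((\<lambda>z. (?h z - ?h x) / (z - x)) \<longlongrightarrow> - w x) (at_right x)"
  proof (rule tendsto_sandwich)
    show "\<forall>\<^sub>F z in at_right x. - w x \<le> (?h z - ?h x) / (z - x)"
      using eventually_at_right_less[of x]
      by eventually_elim (use x0 tail_integral_decrement(2) in \<open>force simp: field_simps\<close>)
    show "\<forall>\<^sub>F z in at_right x. (?h z - ?h x) / (z - x) \<le> - w z"
      using eventually_at_right_less[of x]
      by eventually_elim (use x0 tail_integral_decrement(1) in \<open>force simp: field_simps\<close>)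
    show "((\<lambda>z. - w z) \<longlongrightarrow> - w x) (at_right x)"
      by (intro tendsto_minus right_continuous x0)
  qed simp
  with lim show ?thesis
    using tendsto_unique[OF trivial_limit_at_right_real] by blast
qed

text \<open>With \<open>h\<close> the tail integral, \<open>h' = - w\<close> and the beta function equals \<open>h (1/w)'\<close>. Since \<open>h\<close>
  decreases, \<open>(1/w)' \<le> B/h(z2)\<close> on \<open>[z1, z2]\<close>.\<close>
lemma inverse_profile_increment:
  assumes z: "0 \<le> z1" "z1 \<le> z2" and pos: "0 < w z2"
  shows "1 / w z2 - 1 / w z1 \<le> B * (z2 - z1) / tail_integral w z2"
proof (cases "z1 = z2")
  case False
  then have less: "z1 < z2" using z by simp
  define I where "I = beta_dom \<mu>"
  define h where "h = tail_integral w"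
  define d where "d = deriv_on I (deriv_on I h)"
  have hz2: "0 < h z2"
    unfolding h_def using z pos by (intro tail_integral_pos) auto
  have sub: "{z1..z2} \<subseteq> I"
    using z pos decreasing by (auto simp: dom_eq I_def intro: less_le_trans)
  have deriv_w: "(w has_real_derivative - d x) (at x within I)" if "x \<in> I" for x
  proof -
    have "deriv_on I h differentiable (at x within I)"
      using C2 that by (simp add: C2_on_def differentiable_on_def I_def h_def)
    then have "(deriv_on I h has_vector_derivative d x) (at x within I)"
      unfolding d_def deriv_on_def[of _ "deriv_on I h"] by (rule vector_derivative_works[THEN iffD1])
    then have "((\<lambda>x. - deriv_on I h x) has_vector_derivative - d x) (at x within I)"
      by (rule has_vector_derivative_minus)
    then have "(w has_vector_derivative - d x) (at x within I)"
      by (rule has_vector_derivative_transform[OF that, rotated])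
        (simp add: deriv_tail_integral I_def h_def)
    then show ?thesis
      by (simp add: has_real_derivative_iff_has_vector_derivative)
  qed
  have "\<exists>x\<in>{z1<..<z2}. 1 / w z2 - 1 / w z1 = (\<lambda>t. d x / (w x)\<^sup>2 * t) (z2 - z1)"
  proof (rule mvt_simple[OF less])
    fix x assume "z1 \<le> x" "x \<le> z2"
    then have x: "x \<in> I" using sub by auto
    then have "w x \<noteq> 0" by (auto simp: I_def dom_eq)
    have "(w has_real_derivative - d x) (at x within {z1..z2})"
      by (rule has_field_derivative_subset[OF deriv_w[OF x] sub])
    then have "((\<lambda>x. 1 / w x) has_real_derivative d x / (w x)\<^sup>2) (at x within {z1..z2})"
      using \<open>w x \<noteq> 0\<close> by (auto intro!: derivative_eq_intros simp: power2_eq_square)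
    then show "((\<lambda>x. 1 / w x) has_derivative (\<lambda>t. d x / (w x)\<^sup>2 * t)) (at x within {z1..z2})"
      by (simp only: has_field_derivative_def)
  qed
  then obtain x where x: "z1 < x" "x < z2"
    and eq: "1 / w z2 - 1 / w z1 = d x / (w x)\<^sup>2 * (z2 - z1)"
    by auto
  have xI: "x \<in> I" using sub x by auto
  have "beta_fun w \<mu> x = d x * h x / (w x)\<^sup>2"
    using deriv_tail_integral[of x] xI by (simp add: beta_fun_def Let_def d_def h_def I_def)
  then have le: "d x / (w x)\<^sup>2 * h x \<le> B"
    using beta_le[of x] xI by (simp add: I_def)
  have hx: "h z2 \<le> h x"
    unfolding h_def using x z by (intro tail_integral_decreasing) auto
  have "d x / (w x)\<^sup>2 \<le> B / h x"
    using le hx hz2 by (simp add: pos_le_divide_eq)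
  also have "\<dots> \<le> B / h z2"
    using B_nonneg hx hz2 by (simp add: divide_left_mono)
  finally have "d x / (w x)\<^sup>2 * (z2 - z1) \<le> B / h z2 * (z2 - z1)"
    using less by (intro mult_right_mono) auto
  then show ?thesis using eq by (simp add: h_def)
qed simp

end

section \<open>Invariance under convex reparametrisation\<close>

context decreasing_profile begin

lemma support_of_tail_integral_pos:
  assumes x: "0 \<le> x" and pos: "0 < tail_integral f x"
  shows "0 < f x"
proof (rule ccontr)
  assume "\<not> 0 < f x"
  then have "f y = 0" if "x \<le> y" for y
    using decreasing[of x y] nonneg[of y] that x by auto
  then have "tail_integral f x = (LBINT x:{x..}. 0::real)"
    unfolding tail_integral_def by (subst set_lebesgue_integral_cong[where g = "\<lambda>_. 0"]) auto
  with pos show False by (simp add: set_lebesgue_integral_def)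
qed

lemma tail_integral_affine_comparison:
  assumes g: "decreasing_profile g" and s: "0 < s" and x: "0 \<le> x" and z: "0 \<le> z"
    and le: "\<And>y. x \<le> y \<Longrightarrow> g y \<le> f (z + s * (y - x))"
  shows "s * tail_integral g x \<le> tail_integral f z"
proof -
  interpret g: decreasing_profile g by (rule g)
  define p where "p y = indicator {z..} y *\<^sub>R f y" for y
  have p: "integrable lborel p"
    using integrable_subset[of "{z..}"] z unfolding p_def set_integrable_def by auto
  have ind: "p (z - s * x + s * y) = indicator {x..} y *\<^sub>R f (z + s * (y - x))" for y
  proof -
    have eq: "z - s * x + s * y = z + s * (y - x)" by (simp add: algebra_simps)
    show ?thesis
      unfolding p_def eq using s by (simp add: indicator_def zero_le_mult_iff)
  qed
  have "tail_integral g x \<le> (LBINT y:{x..}. f (z + s * (y - x)))"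
    unfolding tail_integral_def
  proof (rule set_integral_mono)
    show "set_integrable lborel {x..} g"
      using x by (intro g.integrable_subset) auto
    show "set_integrable lborel {x..} (\<lambda>y. f (z + s * (y - x)))"
      using lborel_integrable_real_affine[OF p, of s "z - s * x"] s
      unfolding set_integrable_def ind by simp
  qed (use le in auto)
  also have "s * (LBINT y:{x..}. f (z + s * (y - x))) = tail_integral f z"
    using lborel_integral_real_affine[of s p "z - s * x"] s
    unfolding ind by (simp add: tail_integral_def set_lebesgue_integral_def p_def[abs_def])
  finally show ?thesis using s by simp
qed

end

context beta_bounded_profile begin

text \<open>The bound on the beta function is inherited by \<open>g = w \<circ> F\<close> for convex increasing \<open>F\<close>. With \<open>s\<close> the
  slope of the chord of \<open>F\<close> over \<open>[0, x]\<close>, convexity gives \<open>F y \<ge> F x + s (y - x)\<close> for \<open>y \<ge> x\<close>, so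
  the tail integrals satisfy \<open>s h\<^sub>g(x) \<le> h\<^sub>w(F x)\<close>, and the factor \<open>s\<close> cancels against
  \<open>F x - F 0 = s x\<close>.\<close>
lemma reparametrised_inverse_increment:
  assumes g: "decreasing_profile g" and eq: "\<And>x. 0 \<le> x \<Longrightarrow> g x = w (F x)"
    and conv: "convex_on {0..} F" and mono: "mono_on {0..} F" and F0: "0 \<le> F 0"
    and x: "0 \<le> x" and pos: "0 < g x"
  shows "1 / g x - 1 / g 0 \<le> B * x / tail_integral g x"
proof (cases "F x = F 0")
  case True
  interpret g: decreasing_profile g by (rule g)
  show ?thesis
    using True x eq[of x] eq[of 0] B_nonneg g.tail_integral_nonneg by simp
next
  case False
  interpret g: decreasing_profile g by (rule g)
  have F: "F 0 < F x"
    using False mono_onD[OF mono, of 0 x] x by simp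
  then have x: "0 < x" using x by (cases "x = 0") auto
  define s where "s = (F x - F 0) / x"
  have s: "0 < s" and sx: "s * x = F x - F 0"
    using F x by (auto simp: s_def)
  have Fx: "0 \<le> F x" using F F0 by simp
  have tail: "s * tail_integral g x \<le> tail_integral w (F x)"
  proof (rule tail_integral_affine_comparison[OF g s _ Fx])
    fix y assume y: "x \<le> y"
    then have "0 < y" using x by simp
    have "F ((1 - x / y) *\<^sub>R 0 + (x / y) *\<^sub>R y) \<le> (1 - x / y) * F 0 + (x / y) * F y"
      using x y by (intro convex_onD[OF conv]) auto
    then have "F x \<le> F 0 + (x / y) * (F y - F 0)"
      using \<open>0 < y\<close> by (simp add: algebra_simps)
    then have "y * (F x - F 0) \<le> x * (F y - F 0)"
      using \<open>0 < y\<close> by (simp add: field_simps)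
    then have "y * s \<le> F y - F 0"
      using x by (simp add: s_def field_simps)
    then have "F x + s * (y - x) \<le> F y"
      using sx by (simp add: algebra_simps)
    then show "g y \<le> w (F x + s * (y - x))"
      using eq[of y] x y s Fx by (auto intro!: decreasing)
  qed (use x in simp)
  have wx: "0 < w (F x)" using pos eq x by simp
  have hF: "0 < tail_integral w (F x)" by (rule tail_integral_pos[OF Fx wx])
  have "1 / g x - 1 / g 0 \<le> B * (F x - F 0) / tail_integral w (F x)"
    using inverse_profile_increment[OF F0 _ wx] F x eq by simp
  also have "\<dots> = B * x * (s / tail_integral w (F x))"
    using sx by (metis (no_types, lifting) mult.assoc mult.commute times_divide_eq_right)
  finally have le: "1 / g x - 1 / g 0 \<le> B * x * (s / tail_integral w (F x))" .
  \<comment> \<open>\<open>w\<close> is still positive at some \<open>v > F x\<close>, and \<open>F\<close>, being convex, does not jump over \<open>v\<close>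
    immediately to the right of \<open>x\<close>.\<close>
  have tg: "0 < tail_integral g x"
  proof -
    obtain v where v: "F x < v" "0 < w v" using support_right_open[OF Fx wx] by blast
    define D where "D = F (x + 1) - F x"
    have D: "0 \<le> D" using mono_onD[OF mono, of x "x + 1"] x by (simp add: D_def)
    define r where "r = min 1 ((v - F x) / (D + 1))"
    have r: "0 < r" "r \<le> 1" using v D by (auto simp: r_def)
    have "r * D \<le> (v - F x) / (D + 1) * D"
      using D by (intro mult_right_mono) (auto simp: r_def)
    also have "\<dots> \<le> v - F x" using v D by (simp add: field_simps)
    finally have rD: "F x + r * D \<le> v" by simp
    have "F ((1 - r) *\<^sub>R x + r *\<^sub>R (x + 1)) \<le> (1 - r) * F x + r * F (x + 1)"
      using x r by (intro convex_onD[OF conv]) auto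
    then have "F (x + r) \<le> F x + r * D" by (simp add: algebra_simps D_def)
    moreover have "F x \<le> F (x + r)" using mono_onD[OF mono, of x "x + r"] x r by simp
    ultimately have "w v \<le> w (F (x + r))" using rD Fx by (intro decreasing) auto
    then have "0 < g (x + r)" using v eq[of "x + r"] x r by simp
    then have "0 < r * g (x + r)" using r by simp
    also have "\<dots> \<le> tail_integral g x - tail_integral g (x + r)"
      using g.tail_integral_decrement(1)[of x "x + r"] x r by simp
    also have "\<dots> \<le> tail_integral g x"
      using g.tail_integral_nonneg[of "x + r"] x r by simp
    finally show ?thesis .
  qed
  have "s / tail_integral w (F x) \<le> 1 / tail_integral g x"
    using tail tg hF by (simp add: field_simps)
  then have "B * x * (s / tail_integral w (F x)) \<le> B * x * (1 / tail_integral g x)"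
    using B_nonneg x by (intro mult_left_mono) auto
  with le show ?thesis by simp
qed

end

section \<open>Half of the mass lies at the scale of the mean\<close>

lemma integral_inverse_affine:
  fixes a b K :: real
  assumes "0 < a" "0 < b" "0 \<le> K"
  shows "set_integrable lborel {0..K} (\<lambda>x. 1 / (a + b * x))"
    and "(LBINT x:{0..K}. 1 / (a + b * x)) = ln (1 + b * K / a) / b"
proof -
  have pos: "0 < a + b * x" if "0 \<le> x" for x
    using assms that by (simp add: add_pos_nonneg)
  have cont: "continuous_on {0..K} (\<lambda>x. 1 / (a + b * x))"
    using pos by (intro continuous_intros) force
  then show "set_integrable lborel {0..K} (\<lambda>x. 1 / (a + b * x))"
    by (intro borel_integrable_atLeastAtMost') auto
  have "(LBINT x:{0..K}. 1 / (a + b * x)) = ln (a + b * K) / b - ln (a + b * 0) / b"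
    unfolding set_lebesgue_integral_def
  proof (rule integral_FTC_atLeastAtMost[OF assms(3) _ cont])
    fix x assume "0 \<le> x" "x \<le> K"
    then have "((\<lambda>x. ln (a + b * x) / b) has_real_derivative 1 / (a + b * x)) (at x within {0..K})"
      using pos[of x] assms by (auto intro!: derivative_eq_intros)
    then show "((\<lambda>x. ln (a + b * x) / b) has_vector_derivative 1 / (a + b * x)) (at x within {0..K})"
      by (simp add: has_real_derivative_iff_has_vector_derivative)
  qed
  also have "\<dots> = (ln (a + b * K) - ln a) / b"
    by (simp add: diff_divide_distrib)
  also have "ln (a + b * K) - ln a = ln ((a + b * K) / a)"
    using pos[of K] assms by (simp add: ln_div)
  also have "(a + b * K) / a = 1 + b * K / a"
    using assms by (simp add: add_divide_distrib)
  finally show "(LBINT x:{0..K}. 1 / (a + b * x)) = ln (1 + b * K / a) / b" .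
qed

context decreasing_profile begin

lemma integral_Icc:
  assumes "0 \<le> K" shows "(LBINT x:{0..K}. f x) = 1 - tail_integral f K"
proof -
  have "(LBINT x:{0..K}. f x) = (LBINT x:{0..<K}. f x)"
  proof (rule set_integral_cong_set)
    show "set_borel_measurable lborel {0..K} f" "set_borel_measurable lborel {0..<K} f"
      unfolding set_borel_measurable_def
      by (intro borel_measurable_integrable integrable_subset[unfolded set_integrable_def]; auto)+
    show "AE x in lborel. (x \<in> {0..<K}) = (x \<in> {0..K})"
      using AE_lborel_singleton[of K] by eventually_elim auto
  qed
  then show ?thesis
    using tail_integral_split[of 0 K] tail_integral_0 assms by simp
qed

text \<open>If the tail integral exceeded \<open>1/2\<close> at \<open>K = exp B / (2 * B) / f 0\<close>, then \<open>f x \<ge> 1/(1/f 0 + 2 B x)\<close> on \<open>[0, K]\<close>. The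
  constant in \<open>K\<close> is chosen so that the integral of this lower bound is \<open>ln (1 + exp B)/(2 B)\<close>, which
  exceeds \<open>1/2\<close>.\<close>
lemma tail_integral_le_half:
  assumes B: "0 < B"
    and incr: "\<And>x. 0 \<le> x \<Longrightarrow> 0 < f x \<Longrightarrow> 1 / f x - 1 / f 0 \<le> B * x / tail_integral f x"
  shows "tail_integral f (exp B / (2 * B) / f 0) \<le> 1 / 2"
proof (rule ccontr)
  define K where "K = exp B / (2 * B) / f 0"
  assume "\<not> tail_integral f (exp B / (2 * B) / f 0) \<le> 1 / 2"
  then have half: "1 / 2 < tail_integral f K" by (simp add: K_def)
  have K: "0 \<le> K" using B positive_at_0 by (simp add: K_def)
  have "1 / 2 = B / (2 * B)" using B by simp
  also have "\<dots> < ln (1 + exp B) / (2 * B)"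
  proof (rule divide_strict_right_mono)
    have "ln (exp B) < ln (1 + exp B)"
      by (subst ln_less_cancel_iff) (auto simp: add_pos_pos)
    then show "B < ln (1 + exp B)" by simp
  qed (use B in simp)
  also have "exp B = 2 * B * K / (1 / f 0)"
    using B positive_at_0 by (simp add: K_def)
  also have "ln (1 + 2 * B * K / (1 / f 0)) / (2 * B) = (LBINT x:{0..K}. 1 / (1 / f 0 + 2 * B * x))"
    using B positive_at_0 K by (intro integral_inverse_affine(2)[symmetric]) auto
  also have "\<dots> \<le> (LBINT x:{0..K}. f x)"
  proof (rule set_integral_mono)
    show "set_integrable lborel {0..K} (\<lambda>x. 1 / (1 / f 0 + 2 * B * x))"
      using B positive_at_0 K by (intro integral_inverse_affine(1)) auto
    show "set_integrable lborel {0..K} f" by (rule integrable_subset) auto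
    fix x assume "x \<in> {0..K}"
    then have x: "0 \<le> x" "x \<le> K" by auto
    have tail: "1 / 2 < tail_integral f x"
      using half tail_integral_decreasing[OF x] by simp
    then have pos: "0 < f x"
      by (intro support_of_tail_integral_pos x) auto
    have "B * x / tail_integral f x \<le> B * x / (1 / 2)"
      using tail B x by (intro divide_left_mono) auto
    then have "1 / f x \<le> 1 / f 0 + 2 * B * x"
      using incr[OF x(1) pos] by simp
    moreover have "0 < 1 / f 0 + 2 * B * x"
      using positive_at_0 B x by (simp add: add_pos_nonneg)
    ultimately show "1 / (1 / f 0 + 2 * B * x) \<le> f x"
      using pos by (simp add: divide_le_eq mult.commute)
  qed
  also have "\<dots> = 1 - tail_integral f K" by (rule integral_Icc[OF K])
  finally show False using half by simp
qed

end

section \<open>The flow of the LSW system\<close>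

locale lsw_flow = beta_bounded_profile w0 \<mu> B for w0 :: "real \<Rightarrow> real" and \<mu> B +
  fixes L :: "real \<Rightarrow> real" and w :: "real \<Rightarrow> real \<Rightarrow> real"
  assumes solution: "lsw_solution w0 L w"
begin

lemma L_pos: "0 \<le> s \<Longrightarrow> 0 < L s"
  using solution by (simp add: lsw_solution_def)

lemma ex_characteristic:
  "0 \<le> t \<Longrightarrow> 0 \<le> x \<Longrightarrow> \<exists>y. lsw_characteristic L x t y \<and> w x t = w0 (y 0)"
  using solution by (simp add: lsw_solution_def)

text \<open>The backward flow map \<open>F(x,t)\<close>, the position at time \<open>0\<close> of the characteristic through \<open>x\<close> at
  time \<open>t\<close>. The choice is immaterial, since all such characteristics have the same foot.\<close>
definition foot :: "real \<Rightarrow> real \<Rightarrow> real" where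
  "foot x t = (SOME y. lsw_characteristic L x t y) 0"

lemma foot_eq:
  assumes t: "0 \<le> t" and y: "lsw_characteristic L x t y"
  shows "foot x t = y 0"
proof -
  have z: "lsw_characteristic L x t (SOME y. lsw_characteristic L x t y)"
    using y by (rule someI[where P = "lsw_characteristic L x t"])
  show ?thesis
    unfolding foot_def
    by (intro antisym characteristic_mono[OF L_pos t z y] characteristic_mono[OF L_pos t y z]) auto
qed

lemma characteristic_foot:
  assumes "0 \<le> t" "0 \<le> x"
  obtains y where "lsw_characteristic L x t y" "y 0 = foot x t"
  using ex_characteristic[OF assms] foot_eq[OF assms(1)] by metis

lemma w_eq: "0 \<le> t \<Longrightarrow> 0 \<le> x \<Longrightarrow> w x t = w0 (foot x t)"
  using ex_characteristic[of t x] foot_eq[of t x] by auto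

lemma foot_nonneg:
  assumes "0 \<le> t" "0 \<le> x" shows "0 \<le> foot x t"
proof -
  obtain y where y: "lsw_characteristic L x t y" "y 0 = foot x t"
    by (rule characteristic_foot[OF assms])
  show ?thesis
    using characteristic_nonneg[OF y(1), of 0] y(2) assms by simp
qed

lemma foot_increment:
  assumes t: "0 \<le> t" and x: "0 \<le> x1" "x1 \<le> x2"
  shows "foot x1 t \<le> foot x2 t" "foot x2 t - foot x1 t \<le> x2 - x1"
proof -
  have x2: "0 \<le> x2" using x by simp
  obtain y1 where y1: "lsw_characteristic L x1 t y1" "y1 0 = foot x1 t"
    by (rule characteristic_foot[OF t x(1)])
  obtain y2 where y2: "lsw_characteristic L x2 t y2" "y2 0 = foot x2 t"
    by (rule characteristic_foot[OF t x2])
  show "foot x1 t \<le> foot x2 t" "foot x2 t - foot x1 t \<le> x2 - x1"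
    using characteristic_mono[OF L_pos t y1(1) y2(1) x(2)]
      characteristic_nonexpansive[OF L_pos t y1(1) y2(1) x(2)] y1(2) y2(2) by auto
qed

lemmas foot_mono = foot_increment(1) and foot_nonexpansive = foot_increment(2)

lemma foot_convex: assumes t: "0 \<le> t" shows "convex_on {0..} (\<lambda>x. foot x t)"
proof (rule convex_onI)
  fix r x1 x2 :: real assume r: "0 < r" "r < 1" and x: "x1 \<in> {0..}" "x2 \<in> {0..}"
  have nn: "0 \<le> x1" "0 \<le> x2" "0 \<le> (1 - r) * x1 + r * x2" using r x by auto
  obtain y1 where y1: "lsw_characteristic L x1 t y1" "y1 0 = foot x1 t"
    by (rule characteristic_foot[OF t nn(1)])
  obtain y2 where y2: "lsw_characteristic L x2 t y2" "y2 0 = foot x2 t"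
    by (rule characteristic_foot[OF t nn(2)])
  obtain y where y: "lsw_characteristic L ((1 - r) * x1 + r * x2) t y"
    "y 0 = foot ((1 - r) * x1 + r * x2) t"
    by (rule characteristic_foot[OF t nn(3)])
  show "foot ((1 - r) *\<^sub>R x1 + r *\<^sub>R x2) t \<le> (1 - r) * foot x1 t + r * foot x2 t"
    using characteristic_convex[OF L_pos t y1(1) y2(1) y(1)] r y1(2) y2(2) y(2) by simp
qed simp

lemma initial: "0 \<le> x \<Longrightarrow> w x 0 = w0 x"
  using ex_characteristic[of 0 x] characteristic_end by fastforce

lemma profile: assumes t: "0 \<le> t" shows "decreasing_profile (\<lambda>x. w x t)"
proof
  show "0 \<le> w x t" if "0 \<le> x" for x
    using w_eq foot_nonneg nonneg t that by simp
  show "w y t \<le> w x t" if "0 \<le> x" "x \<le> y" for x y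
    using w_eq[of t] foot_nonneg foot_mono decreasing t that by simp
  show "set_integrable lborel {0..} (\<lambda>x. w x t)" "(LBINT x:{0..}. w x t) = 1"
    using solution t by (auto simp: lsw_solution_def)
qed

lemma inverse_increment:
  assumes t: "0 \<le> t" and x: "0 \<le> x" and pos: "0 < w x t"
  shows "1 / w x t - 1 / w 0 t \<le> B * x / tail_integral (\<lambda>x. w x t) x"
proof (rule reparametrised_inverse_increment[OF profile[OF t], where F = "\<lambda>x. foot x t"])
  show "mono_on {0..} (\<lambda>x. foot x t)"
    using foot_mono[OF t] by (intro mono_onI) auto
qed (use w_eq t foot_convex foot_nonneg x pos in auto)

lemma tail_integral_le_half_at:
  assumes "0 < B" "0 \<le> t"
  shows "tail_integral (\<lambda>x. w x t) (exp B / (2 * B) / w 0 t) \<le> 1 / 2"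
  using decreasing_profile.tail_integral_le_half[OF profile assms(1)] inverse_increment assms by blast

lemma right_continuous_at:
  assumes t: "0 \<le> t" and x: "0 \<le> x"
  shows "((\<lambda>x. w x t) \<longlongrightarrow> w x t) (at_right x)"
proof -
  have "((\<lambda>z. w0 (foot z t)) \<longlongrightarrow> w0 (foot x t)) (at_right x)"
  proof (rule tendstoI)
    fix e :: real assume "0 < e"
    then have "\<forall>\<^sub>F z in at_right (foot x t). dist (w0 z) (w0 (foot x t)) < e"
      using right_continuous[OF foot_nonneg[OF t x]] by (rule tendstoD[rotated])
    then obtain b where b: "foot x t < b"
      "\<And>z. foot x t < z \<Longrightarrow> z < b \<Longrightarrow> dist (w0 z) (w0 (foot x t)) < e"
      by (auto simp: eventually_at_right_field)
    have "\<forall>\<^sub>F z in at_right x. z < x + (b - foot x t)"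
      using b by (intro eventually_at_rightI[of x "x + (b - foot x t)"]) auto
    with eventually_at_right_less[of x]
    show "\<forall>\<^sub>F z in at_right x. dist (w0 (foot z t)) (w0 (foot x t)) < e"
    proof eventually_elim
      case (elim z)
      then have "foot x t \<le> foot z t" "foot z t < b"
        using foot_mono[OF t x, of z] foot_nonexpansive[OF t x, of z] by auto
      then show ?case using b(2)[of "foot z t"] \<open>0 < e\<close> by (cases "foot z t = foot x t") auto
    qed
  qed
  then show ?thesis
    unfolding w_eq[OF t x]
  proof (rule Lim_transform_eventually)
    show "\<forall>\<^sub>F z in at_right x. w0 (foot z t) = w z t"
      using eventually_at_right_less[of x] by eventually_elim (use w_eq t x in auto)
  qed
qed

text \<open>The smallness condition on \<open>d\<close> keeps at least half of the mass of \<open>w(\<cdot>,t)\<close> to the right of the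
  point \<open>y t \<le> d\<close> that is about to be transported to \<open>0\<close>.\<close>
lemma volume_step:
  assumes t: "0 \<le> t" and d: "0 \<le> d" "d * w0 0 \<le> 1 / 2"
  shows "1 / w 0 (t + d) \<le> 1 / w 0 t + 2 * B * d"
proof -
  interpret p: decreasing_profile "\<lambda>x. w x t" by (rule profile[OF t])
  have td: "0 \<le> t + d" using t d by simp
  obtain y where y: "lsw_characteristic L 0 (t + d) y" "y 0 = foot 0 (t + d)"
    by (rule characteristic_foot[OF td order_refl])
  have yt: "0 \<le> y t" "y t \<le> d"
    using characteristic_nonneg[OF y(1), of t] characteristic_speed[OF L_pos y(1), of t] t d by auto
  have "foot (y t) t = y 0"
    using t d by (intro foot_eq characteristic_restrict[OF y(1)]) auto
  then have eq: "w 0 (t + d) = w (y t) t"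
    using w_eq[OF td, of 0] w_eq[OF t yt(1)] y by simp
  have pos: "0 < w (y t) t"
    using decreasing_profile.positive_at_0[OF profile[OF td]] eq by simp
  have "w 0 t \<le> w0 0"
    using w_eq[OF t, of 0] foot_nonneg[OF t, of 0] decreasing[of 0 "foot 0 t"] by simp
  then have "y t * w 0 t \<le> d * w0 0"
    using yt p.positive_at_0 by (intro mult_mono) auto
  then have half: "1 / 2 \<le> tail_integral (\<lambda>x. w x t) (y t)"
    using p.tail_integral_decrement(2)[of 0 "y t"] p.tail_integral_0 yt d by simp
  have "1 / w (y t) t - 1 / w 0 t \<le> B * y t / tail_integral (\<lambda>x. w x t) (y t)"
    by (rule inverse_increment[OF t yt(1) pos])
  also have "\<dots> \<le> B * d / (1 / 2)"
    using half yt d B_nonneg by (intro frac_le mult_left_mono) auto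
  finally show ?thesis using eq by simp
qed

lemma volume_growth:
  assumes T: "0 \<le> T"
  shows "1 / w 0 T \<le> 1 / w0 0 + 2 * B * T"
proof -
  obtain n :: nat where n: "2 * T * w0 0 < n"
    using reals_Archimedean2 by blast
  have n0: "0 < real n" using n T positive_at_0 by (smt (verit) mult_nonneg_nonneg)
  define d where "d = T / n"
  have d: "0 \<le> d" "d * w0 0 \<le> 1 / 2" "n * d = T"
    using n n0 T by (auto simp: d_def field_simps)
  have "1 / w 0 (k * d) \<le> 1 / w0 0 + 2 * B * (k * d)" for k :: nat
  proof (induction k)
    case (Suc k)
    have "1 / w 0 (k * d + d) \<le> 1 / w 0 (k * d) + 2 * B * d"
      using d by (intro volume_step) auto
    moreover have "real (Suc k) * d = k * d + d" by (simp add: distrib_right)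
    moreover have "2 * B * (k * d + d) = 2 * B * (k * d) + 2 * B * d" by (simp add: distrib_left)
    ultimately show ?case using Suc by simp
  qed (simp add: initial)
  from this[of n] show ?thesis using d by simp
qed

end

section \<open>Moments of the Lebesgue--Stieltjes measure of a profile\<close>

text \<open>For \<open>A = {0..}\<close> the left-hand side is the first moment of the part of \<open>M\<close> on the nonnegative
  half-line, for \<open>A = {0..K}\<close> it is the integral of \<open>min x K\<close> over that part.\<close>
lemma nn_integral_layer_cake:
  fixes M :: "real measure"
  assumes M: "sigma_finite_measure M" "sets M = sets borel" and A: "A \<in> sets borel"
  shows "(\<integral>\<^sup>+x. emeasure lborel (A \<inter> {..<x}) \<partial>M)
    = (\<integral>\<^sup>+y. indicator A y * emeasure M {y<..} \<partial>lborel)"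
proof -
  interpret sigma_finite_measure M by (rule M)
  interpret pair_sigma_finite M lborel ..
  note M(2)[measurable_cong] A[measurable]
  have "(\<integral>\<^sup>+x. emeasure lborel (A \<inter> {..<x}) \<partial>M)
      = (\<integral>\<^sup>+x. \<integral>\<^sup>+y. indicator A y * indicator {z. fst z > snd z} (x, y) \<partial>lborel \<partial>M)"
  proof (rule nn_integral_cong)
    fix x
    have "emeasure lborel (A \<inter> {..<x}) = (\<integral>\<^sup>+y. indicator (A \<inter> {..<x}) y \<partial>lborel)"
      by (rule nn_integral_indicator[symmetric]) simp
    also have "\<dots> = (\<integral>\<^sup>+y. indicator A y * indicator {z. fst z > snd z} (x, y) \<partial>lborel)"
      by (rule nn_integral_cong) (auto simp: indicator_def)
    finally show "emeasure lborel (A \<inter> {..<x})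
      = (\<integral>\<^sup>+y. indicator A y * indicator {z. fst z > snd z} (x, y) \<partial>lborel)" .
  qed
  also have "\<dots> = (\<integral>\<^sup>+y. \<integral>\<^sup>+x. indicator A y * indicator {z. fst z > snd z} (x, y) \<partial>M \<partial>lborel)"
    by (rule Fubini'[symmetric]) measurable
  also have "\<dots> = (\<integral>\<^sup>+y. indicator A y * emeasure M {y<..} \<partial>lborel)"
  proof (rule nn_integral_cong)
    fix y :: real
    have "(\<integral>\<^sup>+x. indicator A y * indicator {z. fst z > snd z} (x, y) \<partial>M)
        = (\<integral>\<^sup>+x. indicator A y * indicator {y<..} x \<partial>M)"
      by (rule nn_integral_cong) (auto simp: indicator_def)
    also have "\<dots> = indicator A y * emeasure M {y<..}"
      by (simp add: nn_integral_cmult_indicator M(2))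
    finally show "(\<integral>\<^sup>+x. indicator A y * indicator {z. fst z > snd z} (x, y) \<partial>M)
        = indicator A y * emeasure M {y<..}" .
  qed
  finally show ?thesis .
qed

locale right_continuous_profile = decreasing_profile +
  assumes right_cont: "\<And>x. 0 \<le> x \<Longrightarrow> (f \<longlongrightarrow> f x) (at_right x)"
begin

text \<open>The measure \<open>- df\<close> on the positive half-line. Extending \<open>f\<close> by the constant \<open>f 0\<close> to the left
  leaves no mass on \<open>(-\<infinity>, 0]\<close>; the total mass is \<open>f 0\<close>, which need not be \<open>1\<close>.\<close>
definition law :: "real measure" where
  "law = interval_measure (\<lambda>x. - f (max 0 x))"

lemma distribution_mono: "x \<le> y \<Longrightarrow> - f (max 0 x) \<le> - f (max 0 y)"
  by (simp add: decreasing)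

lemma distribution_right_continuous: "continuous (at_right a) (\<lambda>x. - f (max 0 x))"
proof (cases "0 \<le> a")
  case True
  have "((\<lambda>x. - f (max 0 x)) \<longlongrightarrow> - f a) (at_right a)"
  proof (rule Lim_transform_eventually)
    show "((\<lambda>x. - f x) \<longlongrightarrow> - f a) (at_right a)"
      by (intro tendsto_minus right_cont True)
    show "\<forall>\<^sub>F x in at_right a. - f x = - f (max 0 x)"
      using eventually_at_right_less[of a] by eventually_elim (use True in auto)
  qed
  then show ?thesis using True by (simp add: continuous_within)
next
  case False
  have "((\<lambda>x. - f (max 0 x)) \<longlongrightarrow> - f 0) (at_right a)"
  proof (rule Lim_transform_eventually)
    have "\<forall>\<^sub>F x in at_right a. x < 0"
      using False by (intro eventually_at_rightI[of a 0]) auto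
    then show "\<forall>\<^sub>F x in at_right a. - f 0 = - f (max 0 x)"
      by eventually_elim auto
  qed simp
  then show ?thesis using False by (simp add: continuous_within)
qed

lemma sets_law: "sets law = sets borel"
  by (simp add: law_def)

lemma sigma_finite_law: "sigma_finite_measure law"
  unfolding law_def
  by (rule sigma_finite_interval_measure[OF distribution_mono distribution_right_continuous])

lemma emeasure_law_Ioc: "a \<le> b \<Longrightarrow> emeasure law {a<..b} = ennreal (f (max 0 a) - f (max 0 b))"
  unfolding law_def
  using emeasure_interval_measure_Ioc[OF _ distribution_mono distribution_right_continuous, of a b]
  by simp

lemma emeasure_law_Ioi:
  assumes a: "0 \<le> a" shows "emeasure law {a<..} = ennreal (f a)"
proof -
  have "(\<lambda>n. emeasure law {a<..a + real n}) \<longlonglongrightarrow> emeasure law (\<Union>n. {a<..a + real n})"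
    by (rule Lim_emeasure_incseq) (auto simp: sets_law incseq_def)
  moreover have "(\<Union>n. {a<..a + real n}) = {a<..}"
  proof (intro set_eqI iffI)
    fix x assume "x \<in> {a<..}"
    moreover obtain n :: nat where "x - a \<le> n" using real_arch_simple by blast
    ultimately have "x \<in> {a<..a + n}" by simp
    then show "x \<in> (\<Union>n. {a<..a + real n})" by blast
  qed auto
  ultimately have "(\<lambda>n. ennreal (f a - f (a + real n))) \<longlonglongrightarrow> emeasure law {a<..}"
    using a by (simp add: emeasure_law_Ioc)
  moreover have "(\<lambda>n. ennreal (f a - f (a + real n))) \<longlonglongrightarrow> ennreal (f a - 0)"
  proof (intro tendsto_ennrealI tendsto_diff tendsto_const filterlim_compose[OF tendsto_0])
    show "filterlim (\<lambda>n. a + real n) at_top sequentially"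
      by (rule filterlim_tendsto_add_at_top[OF tendsto_const filterlim_real_sequentially])
  qed
  ultimately show ?thesis
    using LIMSEQ_unique by fastforce
qed

lemma measure_law_Ici: "measure law {0..} = f 0"
proof -
  have "emeasure law {0} \<le> emeasure law {-1<..0}"
    by (rule emeasure_mono) (auto simp: sets_law)
  then have "emeasure law {0} = 0"
    by (simp add: emeasure_law_Ioc)
  moreover have "{0::real..} = {0} \<union> {0<..}" by auto
  ultimately have "emeasure law {0..} = ennreal (f 0)"
    using plus_emeasure[of "{0}" law "{0<..}"] by (simp add: sets_law emeasure_law_Ioi)
  then show ?thesis
    by (simp add: measure_def nonneg)
qed

lemma layer_cake:
  assumes A: "A \<in> sets borel" "A \<subseteq> {0..}"
  shows "(\<integral>\<^sup>+x. emeasure lborel (A \<inter> {..<x}) \<partial>law) = ennreal (LBINT y:A. f y)"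
proof -
  have int: "integrable lborel (\<lambda>y. indicator A y * f y)"
    using integrable_subset[OF A(2,1)] by (simp add: set_integrable_def)
  have "(\<integral>\<^sup>+x. emeasure lborel (A \<inter> {..<x}) \<partial>law)
      = (\<integral>\<^sup>+y. ennreal (indicator A y * f y) \<partial>lborel)"
    unfolding nn_integral_layer_cake[OF sigma_finite_law sets_law A(1)]
    using A(2) by (intro nn_integral_cong) (auto simp: indicator_def emeasure_law_Ioi)
  also have "\<dots> = ennreal (LBINT y. indicator A y * f y)"
    using A nonneg by (intro nn_integral_eq_integral int) (auto simp: indicator_def)
  finally show ?thesis by (simp add: set_lebesgue_integral_def)
qed

lemma first_moment: "(LINT x:{0..}|law. x) = 1"
proof -
  have len: "ennreal (indicator {0..} x * x) = emeasure lborel ({0..} \<inter> {..<x})" for x :: real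
  proof (cases "0 \<le> x")
    case True
    have "{0..} \<inter> {..<x} = {0..<x}" by auto
    then show ?thesis using True by simp
  next
    case False
    then have "{0..} \<inter> {..<x} = {}" by auto
    then show ?thesis using False by simp
  qed
  have "(LINT x:{0..}|law. x) = enn2real (\<integral>\<^sup>+x. ennreal (indicator {0..} x * x) \<partial>law)"
    unfolding set_lebesgue_integral_def real_scaleR_def
    by (rule integral_eq_nn_integral) (auto simp: law_def indicator_def)
  also have "\<dots> = 1"
    unfolding len by (subst layer_cake) (auto simp: mass)
  finally show ?thesis .
qed

text \<open>Pointwise \<open>x powr (2/3) \<ge> K powr (-1/3) * min x K\<close>, and the integral of \<open>min x K\<close> is the mass of
  \<open>f\<close> on \<open>[0, K]\<close>.\<close>
lemma fractional_moment_lower_bound: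
  assumes K: "0 < K" and half: "tail_integral f K \<le> 1 / 2"
    and int: "set_integrable law {0..} (\<lambda>x. x powr (2/3))"
  shows "K powr (-1/3) / 2 \<le> (LINT x:{0..}|law. x powr (2/3))"
proof -
  have len: "emeasure lborel ({0..K} \<inter> {..<x}) = ennreal (max 0 (min x K))" for x
  proof -
    consider "x \<le> 0" | "0 < x" "x \<le> K" | "K < x" by linarith
    then show ?thesis
    proof cases
      case 1
      then have "{0..K} \<inter> {..<x} = {}" by auto
      then show ?thesis using 1 K by simp
    next
      case 2
      then have "{0..K} \<inter> {..<x} = {0..<x}" by auto
      then show ?thesis using 2 by simp
    next
      case 3
      then have "{0..K} \<inter> {..<x} = {0..K}" by auto
      then show ?thesis using 3 K by simp
    qed
  qed
  have le: "K powr (-1/3) * max 0 (min x K) \<le> indicator {0..} x * x powr (2/3)" for x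
  proof (cases "0 < x")
    case True
    define m where "m = min x K"
    have m: "0 < m" "m \<le> x" "m \<le> K" using True K by (auto simp: m_def)
    have "K powr (-1/3) * m = K powr (-1/3) * m powr (1/3) * m powr (2/3)"
      using m powr_add[of m "1/3" "2/3"] by simp
    also have "\<dots> \<le> K powr (-1/3) * K powr (1/3) * x powr (2/3)"
      using m by (intro mult_mono mult_left_mono powr_mono2) auto
    also have "\<dots> = x powr (2/3)"
      using K powr_add[of K "-1/3" "1/3"] by simp
    finally show ?thesis using True m by (simp add: m_def)
  qed (auto simp: indicator_def)
  have I: "1 / 2 \<le> (LBINT y:{0..K}. f y)"
    using integral_Icc[of K] half K by simp
  have "K powr (-1/3) / 2 \<le> K powr (-1/3) * (LBINT y:{0..K}. f y)"
    using mult_left_mono[OF I, of "K powr (-1/3)"] by simp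
  then have "ennreal (K powr (-1/3) / 2) \<le> ennreal (K powr (-1/3)) * ennreal (LBINT y:{0..K}. f y)"
    using I by (subst ennreal_mult[symmetric]) (auto intro!: ennreal_leI)
  also have "\<dots> = ennreal (K powr (-1/3)) * (\<integral>\<^sup>+x. emeasure lborel ({0..K} \<inter> {..<x}) \<partial>law)"
    by (subst layer_cake) auto
  also have "\<dots> = (\<integral>\<^sup>+x. ennreal (K powr (-1/3) * max 0 (min x K)) \<partial>law)"
    unfolding len by (subst nn_integral_cmult[symmetric]) (auto simp: law_def ennreal_mult)
  also have "\<dots> \<le> (\<integral>\<^sup>+x. ennreal (indicator {0..} x * x powr (2/3)) \<partial>law)"
    by (intro nn_integral_mono ennreal_leI le)
  also have "\<dots> = ennreal (LINT x:{0..}|law. x powr (2/3))"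
    using int unfolding set_integrable_def set_lebesgue_integral_def real_scaleR_def
    by (rule nn_integral_eq_integral) auto
  finally show ?thesis
    by (subst (asm) ennreal_le_iff) (auto simp: set_lebesgue_integral_def intro!: Bochner_Integration.integral_nonneg)
qed

lemma inverse_cubed_fractional_moment:
  assumes K: "0 < K" and half: "tail_integral f K \<le> 1 / 2"
  shows "1 / (LINT x:{0..}|law. x powr (2/3)) ^ 3 \<le> 8 * K"
proof (cases "set_integrable law {0..} (\<lambda>x. x powr (2/3))")
  case True
  let ?E = "LINT x:{0..}|law. x powr (2/3)"
  have "(K powr (-1/3) / 2) ^ 3 \<le> ?E ^ 3"
    by (intro power_mono fractional_moment_lower_bound K half True) simp
  moreover have "(K powr (-1/3) / 2) ^ 3 = 1 / (8 * K)"
    using K by (simp add: power_divide powr_power powr_minus_divide)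
  ultimately have "inverse (?E ^ 3) \<le> inverse (1 / (8 * K))"
    using K by (intro le_imp_inverse_le) auto
  then show ?thesis by (simp add: inverse_eq_divide)
next
  \<comment> \<open>A divergent moment has integral \<open>0\<close> by convention, and then so is the quotient.\<close>
  case False
  then show ?thesis
    using K by (simp add: set_lebesgue_integral_def set_integrable_def not_integrable_integral_eq)
qed

text \<open>The normalised integral is the moment of order \<open>1/3\<close> of the law with tail \<open>f x / f 0\<close>. It is
  integrable because its value is not \<open>0\<close>.\<close>
lemma scale_bound_of_normalised_moment:
  assumes K: "0 < K" and half: "tail_integral f K \<le> 1 / 2"
    and moment: "(1/3) * (LBINT x:{0..}. x powr (-2/3) * f x) / f 0 = 1"
  shows "1 / f 0 \<le> 6 * K powr (2/3)"
proof -
  define I where "I = (LBINT x:{0..}. x powr (-2/3) * f x)"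
  have I: "I = 3 * f 0"
    using moment positive_at_0 by (simp add: I_def field_simps)
  have int: "set_integrable lborel {0..} (\<lambda>x. x powr (-2/3) * f x)"
    using I positive_at_0 not_integrable_integral_eq
    unfolding I_def set_integrable_def set_lebesgue_integral_def by force
  have "K powr (-2/3) * (1 / 2) \<le> K powr (-2/3) * (LBINT x:{0..K}. f x)"
    using integral_Icc[of K] half K by (intro mult_left_mono) auto
  also have "\<dots> = (LBINT x:{0..K}. K powr (-2/3) * f x)"
    by simp
  also have "\<dots> \<le> (LBINT x:{0..K}. x powr (-2/3) * f x)"
  proof (rule set_integral_mono_AE)
    show "set_integrable lborel {0..K} (\<lambda>x. K powr (-2/3) * f x)"
      by (intro set_integrable_mult_right integrable_subset) auto
    show "set_integrable lborel {0..K} (\<lambda>x. x powr (-2/3) * f x)"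
      by (rule set_integrable_subset[OF int]) auto
    show "AE x \<in> {0..K} in lborel. K powr (-2/3) * f x \<le> x powr (-2/3) * f x"
      using AE_lborel_singleton[of 0]
    proof eventually_elim
      case (elim x)
      show ?case
      proof
        assume "x \<in> {0..K}"
        then show "K powr (-2/3) * f x \<le> x powr (-2/3) * f x"
          using elim by (intro mult_right_mono powr_mono2' nonneg) auto
      qed
    qed
  qed
  also have "\<dots> \<le> I"
    unfolding I_def set_lebesgue_integral_def
  proof (rule integral_mono)
    show "integrable lborel (\<lambda>x. indicator {0..K} x *\<^sub>R (x powr (-2/3) * f x))"
      using set_integrable_subset[OF int, of "{0..K}"] by (auto simp: set_integrable_def)
    show "integrable lborel (\<lambda>x. indicator {0..} x *\<^sub>R (x powr (-2/3) * f x))"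
      using int by (simp add: set_integrable_def)
  qed (auto simp: indicator_def nonneg)
  finally have "K powr (-2/3) \<le> 6 * f 0" using I by simp
  then have "K powr (-2/3) * K powr (2/3) \<le> 6 * f 0 * K powr (2/3)"
    by (intro mult_right_mono) auto
  moreover have "K powr (-2/3) * K powr (2/3) = 1"
    using K powr_add[of K "-2/3" "2/3"] by simp
  ultimately show ?thesis
    using positive_at_0 by (simp add: field_simps)
qed

end

section \<open>Coarsening bounds\<close>

context lsw_flow begin

lemma right_continuous_profile_at: "0 \<le> t \<Longrightarrow> right_continuous_profile (\<lambda>x. w x t)"
  using profile right_continuous_at
  by (intro right_continuous_profile.intro right_continuous_profile_axioms.intro) auto

lemma law_eq: "0 \<le> t \<Longrightarrow> right_continuous_profile.law (\<lambda>x. w x t) = cluster_measure w t"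
  by (simp add: right_continuous_profile.law_def[OF right_continuous_profile_at] cluster_measure_def)

lemma mean_volume_eq:
  assumes t: "0 \<le> t" shows "mean_volume w t = 1 / w 0 t"
proof -
  interpret p: right_continuous_profile "\<lambda>x. w x t" by (rule right_continuous_profile_at[OF t])
  have "(LINT x:{0..}|p.law. 1) = measure p.law {0..}"
    by (simp add: set_lebesgue_integral_def p.sets_law)
  then show ?thesis
    using p.first_moment p.measure_law_Ici by (simp add: mean_volume_def law_eq[OF t])
qed

lemma inverse_cubed_energy_bound:
  assumes t: "0 \<le> t" and K: "0 < K" "tail_integral (\<lambda>x. w x t) K \<le> 1 / 2"
  shows "1 / energy w t ^ 3 \<le> 8 * K"
  using right_continuous_profile.inverse_cubed_fractional_moment[OF right_continuous_profile_at[OF t] K]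
  by (simp add: energy_def law_eq[OF t])

text \<open>Writing \<open>V\<close> for the mean volume, \<open>L(0) = 1\<close> gives \<open>V \<le> 6 (k V) powr (2/3)\<close>. The exponent is
  less than \<open>1\<close>, so this bounds \<open>V\<close>; cubing avoids fractional powers of \<open>V\<close>.\<close>
lemma initial_volume_bound:
  assumes L0: "L 0 = 1" and B: "0 < B"
  shows "1 / w0 0 \<le> 216 * (exp B / (2 * B))\<^sup>2"
proof -
  define k where "k = exp B / (2 * B)"
  define V where "V = 1 / w 0 0"
  have k: "0 < k" using B by (simp add: k_def)
  interpret p: right_continuous_profile "\<lambda>x. w x 0" by (rule right_continuous_profile_at) simp
  have V: "0 < V" using p.positive_at_0 by (simp add: V_def)
  have half: "tail_integral (\<lambda>x. w x 0) (k * V) \<le> 1 / 2"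
    using tail_integral_le_half_at[OF B, of 0] by (simp add: k_def V_def)
  have "root 3 (L 0) = (1/3) * (LBINT x:{0..}. x powr (-2/3) * w x 0) / w 0 0"
    using solution unfolding lsw_solution_def by blast
  then have "(1/3) * (LBINT x:{0..}. x powr (-2/3) * w x 0) / w 0 0 = 1"
    using L0 by simp
  then have "V \<le> 6 * (k * V) powr (2/3)"
    unfolding V_def using k V half
    by (intro p.scale_bound_of_normalised_moment) (auto simp: V_def)
  then have "V ^ 3 \<le> (6 * (k * V) powr (2/3)) ^ 3"
    using V by (intro power_mono) auto
  also have "\<dots> = 216 * (k * V)\<^sup>2"
    using k V by (simp add: power_mult_distrib powr_power powr_numeral)
  finally have "V * V\<^sup>2 \<le> 216 * k\<^sup>2 * V\<^sup>2"
    by (simp add: power_mult_distrib power2_eq_square power3_eq_cube algebra_simps)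
  then have "V \<le> 216 * k\<^sup>2" using V by simp
  then show ?thesis by (simp add: V_def k_def initial)
qed

lemma coarsening_bounds:
  fixes k C :: real
  defines "k \<equiv> exp B / (2 * B)"
  defines "C \<equiv> 216 * k\<^sup>2 + 2 * B"
  assumes L0: "L 0 = 1" and B: "0 < B" and T: "1 < T"
  shows "mean_volume w T \<le> C * T" "1 / energy w T ^ 3 \<le> 8 * k * C * T"
proof -
  have k: "0 < k" using B by (simp add: k_def)
  have T0: "0 \<le> T" using T by simp
  have "1 / w 0 T \<le> 216 * k\<^sup>2 + 2 * B * T"
    using volume_growth[OF T0] initial_volume_bound[OF L0 B] unfolding k_def by linarith
  also have "216 * k\<^sup>2 \<le> 216 * k\<^sup>2 * T"
    using T by (simp add: mult_le_cancel_left1)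
  finally have V: "1 / w 0 T \<le> C * T" by (simp add: C_def distrib_right)
  then show "mean_volume w T \<le> C * T" by (simp add: mean_volume_eq[OF T0])
  have "0 < w 0 T" by (rule decreasing_profile.positive_at_0[OF profile[OF T0]])
  then have "1 / energy w T ^ 3 \<le> 8 * (k / w 0 T)"
    using k tail_integral_le_half_at[OF B T0, folded k_def]
    by (intro inverse_cubed_energy_bound T0) auto
  also have "\<dots> \<le> 8 * k * (C * T)"
    using mult_left_mono[OF V, of "8 * k"] k by simp
  finally show "1 / energy w T ^ 3 \<le> 8 * k * C * T" by (simp add: mult.assoc)
qed

end

theorem proposition4p2:
  fixes \<beta>_inf :: real
  shows "\<exists>C::real. \<forall>(w0 :: real \<Rightarrow> real) (\<mu> :: real measure) (L :: real \<Rightarrow> real) (w :: real \<Rightarrow> real \<Rightarrow> real).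
    (\<forall>x\<ge>0. 0 \<le> w0 x) \<and> antimono_on {0..} w0 \<and>
    set_integrable lborel {0..} w0 \<and> (LBINT x:{0..}. w0 x) = 1 \<and>
    beta_exists w0 \<mu> \<and> (\<forall>x\<in>beta_dom \<mu>. beta_fun w0 \<mu> x \<le> \<beta>_inf) \<and>
    lsw_solution w0 L w \<and> L 0 = 1 \<longrightarrow>
    (\<forall>T>1. mean_volume w T \<le> C * T \<and> 1 / (energy w T) ^ 3 \<le> C * T)"
proof -
  \<comment> \<open>The estimates divide by \<open>B\<close>, so \<open>\<beta>_inf\<close> is replaced by a positive bound.\<close>
  define B where "B = max 1 \<beta>_inf"
  define k where "k = exp B / (2 * B)"
  define C where "C = 216 * k\<^sup>2 + 2 * B"
  have B: "0 < B" "\<beta>_inf \<le> B" by (auto simp: B_def)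
  have k: "0 < k" using B by (simp add: k_def)
  have C: "0 < C" using B by (simp add: C_def add_nonneg_pos)
  show ?thesis
  proof (intro exI[of _ "max C (8 * k * C)"] allI impI, elim conjE)
    fix w0 \<mu> L w T
    assume nonneg: "\<forall>x\<ge>0. 0 \<le> w0 x" and anti: "antimono_on {0..} w0"
      and int: "set_integrable lborel {0..} w0" and mass: "(LBINT x:{0..}. w0 x) = 1"
      and beta: "beta_exists w0 \<mu>" "\<forall>x\<in>beta_dom \<mu>. beta_fun w0 \<mu> x \<le> \<beta>_inf"
      and sol: "lsw_solution w0 L w" and L0: "L 0 = 1" and T: "(1::real) < T"
    interpret lsw_flow w0 \<mu> B L w
    proof unfold_locales
      show "0 \<le> w0 x" if "0 \<le> x" for x using nonneg that by simp
      show "w0 y \<le> w0 x" if "0 \<le> x" "x \<le> y" for x y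
        using monotone_onD[OF anti, of x y] that by simp
      show "beta_fun w0 \<mu> x \<le> B" if "x \<in> beta_dom \<mu>" for x
        using beta(2) B(2) that by force
    qed (use int mass beta(1) sol B(1) in auto)
    note bounds = coarsening_bounds[OF L0 B(1) T, folded k_def, folded C_def]
    have "C * T \<le> max C (8 * k * C) * T" "8 * k * C * T \<le> max C (8 * k * C) * T"
      using T by (auto intro!: mult_right_mono)
    with bounds show "mean_volume w T \<le> max C (8 * k * C) * T \<and>
        1 / energy w T ^ 3 \<le> max C (8 * k * C) * T"
      by linarith
  qed
qed

end
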